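(* Let $n\in\mathbb{N}$, $n\ge 1$. For any $y \in \{0,1\}^n$, let $$|\varphi_y\rangle=\frac{1}{\sqrt{2}}|y^Y\rangle + \frac{1}{\sqrt{2}}e^{i\frac{\pi}{4}}|\bar{y}^Y\rangle .$$ Then, for all $\theta \in \{0,1\}^n$, the following holds: with probability $\cos^{2}(\frac{\pi}{8})\approx 0.853$ over performing a measurement of $|\varphi_y\rangle$ in the $\theta$ basis, the outcome string $x$ is such that $\mathrm{parity}(x)$ is $$\begin{cases} y\cdot \theta \bmod 2 & \text{if } |\theta| = 0,1 \bmod 4,\\ y\cdot \theta + 1 \bmod 2 & \text{if } |\theta| = 2,3 \bmod 4.\end{cases}$$ Moreover, let $$|\psi_y\rangle=\frac{1}{\sqrt{2}}|y^Y\rangle - \frac{1}{\sqrt{2}}e^{i\frac{\pi}{4}}|\bar{y}^Y\rangle .$$ Then, for all $\theta \in \{0,1\}^n$, the following holds: with probability $\cos^{2}(\frac{\pi}{8})\approx 0.853$ over performing a measurement of $|\psi_y\rangle$ in the $\theta$ basis, the outcome string $x$ is such that $\mathrm{parity}(x)$ is $$\begin{cases} y\cdot \theta \bmod 2 & \text{if } |\theta| = 0,3 \bmod 4,\\ y\cdot \theta + 1 \bmod 2 & \text{if } |\theta| = 1,2 \bmod 4.\end{cases}$$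
   Context: For $x,\theta \in \{0,1\}^n$, $|x^{\theta}\rangle = \bigotimes_{i=1}^n |x_i^{\theta_i}\rangle \in (\mathbb{C}^2)^{\otimes n}$, where $|0^{\theta_i}\rangle, |1^{\theta_i}\rangle$ are respectively the $+1$ and $-1$ unit eigenvectors of Pauli $Z$ if $\theta_i=0$ (i.e. $|0\rangle,|1\rangle$) and of Pauli $X$ if $\theta_i = 1$ (i.e. $(|0\rangle \pm |1\rangle)/\sqrt{2}$). The $\theta$ basis is $\{|x^\theta\rangle\}_{x\in\{0,1\}^n}$; measuring a unit vector $|\phi\rangle$ in the $\theta$ basis gives outcome string $x$ with probability $|\langle x^\theta|\phi\rangle|^2$. $|0^Y\rangle = \frac{1}{\sqrt{2}}|0\rangle+\frac{i}{\sqrt{2}}|1\rangle$ and $|1^Y\rangle = \frac{1}{\sqrt{2}}|0\rangle-\frac{i}{\sqrt{2}}|1\rangle$ are respectively the $+1$ and $-1$ eigenvectors of Pauli $Y$. For $y\in\{0,1\}^n$, $|y^Y\rangle = |(y_1)^Y\rangle\otimes\cdots\otimes|(y_n)^Y\rangle$, and $\bar y$ is the string obtained by flipping all the bits of $y$. $\mathrm{parity}(x)\in\{0,1\}$ is the XOR of all bits of $x$, $|\theta|$ is the Hamming weight of $\theta$, and $y\cdot\theta=\sum_i y_i\theta_i$.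
   Formalization: The state ψ_y is taken with relative phase +e^{-iπ/4} instead of the printed -e^{iπ/4}, for which the claim fails (n=1, y=θ=0: outcome 0 has probability sin²(π/8)); the parity table is as printed. The numerical value 0.853 is not stated. *)

theory Defs
  imports "HOL-Analysis.Analysis"
begin

text \<open>
  Qubit positions are the elements of a finite type \<open>'n\<close>, so \<open>n = CARD('n) \<ge> 1\<close>. The bits 0 and 1
  are \<open>False\<close> and \<open>True\<close>. A vector of the \<open>n\<close>-fold tensor power of \<open>\<complex>\<^sup>2\<close> is given by its
  coordinates in the computational basis, which is indexed by the bit strings.
\<close>

type_synonym 'n bits = "'n \<Rightarrow> bool"
type_synonym qubit = "complex ^ bool"
type_synonym 'n qubits = "complex ^ ('n \<Rightarrow> bool)"

definition ket_Z :: "bool \<Rightarrow> qubit" where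
  "ket_Z b = axis b 1"

definition ket_X :: "bool \<Rightarrow> qubit" where
  "ket_X b = complex_of_real (1 / sqrt 2) *s
     (if b then ket_Z False - ket_Z True else ket_Z False + ket_Z True)"

definition ket_Y :: "bool \<Rightarrow> qubit" where
  "ket_Y b = (if b
     then complex_of_real (1 / sqrt 2) *s ket_Z False - (\<i> / complex_of_real (sqrt 2)) *s ket_Z True
     else complex_of_real (1 / sqrt 2) *s ket_Z False + (\<i> / complex_of_real (sqrt 2)) *s ket_Z True)"

definition tensor :: "('n::finite \<Rightarrow> qubit) \<Rightarrow> 'n qubits" where
  "tensor v = (\<chi> s. \<Prod>i\<in>UNIV. v i $ s i)"

definition braket :: "complex ^ 'a::finite \<Rightarrow> complex ^ 'a \<Rightarrow> complex" where
  "braket v w = (\<Sum>s\<in>UNIV. cnj (v $ s) * w $ s)"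

definition basis_ket :: "'n::finite bits \<Rightarrow> 'n bits \<Rightarrow> 'n qubits" where
  "basis_ket \<theta> x = tensor (\<lambda>i. if \<theta> i then ket_X (x i) else ket_Z (x i))"

definition string_ket_Y :: "'n::finite bits \<Rightarrow> 'n qubits" where
  "string_ket_Y y = tensor (\<lambda>i. ket_Y (y i))"

definition flip_bits :: "'n bits \<Rightarrow> 'n bits" where
  "flip_bits y = (\<lambda>i. \<not> y i)"

definition outcome_prob :: "'n::finite bits \<Rightarrow> 'n qubits \<Rightarrow> 'n bits \<Rightarrow> real" where
  "outcome_prob \<theta> \<phi> x = (cmod (braket (basis_ket \<theta> x) \<phi>))\<^sup>2"

definition event_prob :: "'n::finite bits \<Rightarrow> 'n qubits \<Rightarrow> ('n bits \<Rightarrow> bool) \<Rightarrow> real" where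
  "event_prob \<theta> \<phi> P = (\<Sum>x | P x. outcome_prob \<theta> \<phi> x)"

definition hamming_weight :: "'n::finite bits \<Rightarrow> nat" where
  "hamming_weight x = card {i. x i}"

definition parity :: "'n::finite bits \<Rightarrow> nat" where
  "parity x = (\<Sum>i\<in>UNIV. of_bool (x i)) mod 2"

definition dot_bits :: "'n::finite bits \<Rightarrow> 'n bits \<Rightarrow> nat" where
  "dot_bits y \<theta> = (\<Sum>i\<in>UNIV. of_bool (y i) * of_bool (\<theta> i))"

definition phi :: "'n::finite bits \<Rightarrow> 'n qubits" where
  "phi y = complex_of_real (1 / sqrt 2) *s string_ket_Y y
     + (complex_of_real (1 / sqrt 2) * exp (\<i> * complex_of_real (pi / 4))) *s string_ket_Y (flip_bits y)"

text \<open>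
  The minus sign belongs in the exponent of the relative phase of \<open>psi\<close>. With \<open>- exp (\<i> * \<pi> / 4)\<close>
  instead of \<open>exp (- \<i> * \<pi> / 4)\<close> the vector would be orthogonal to \<open>phi y\<close>, and its outcome parity
  would follow the complement of the rule for \<open>phi y\<close>: for \<open>n = 1\<close>, \<open>y = \<theta> = 0\<close>, outcome 0 would
  have probability \<open>sin\<^sup>2 (\<pi> / 8)\<close>.
\<close>

definition psi :: "'n::finite bits \<Rightarrow> 'n qubits" where
  "psi y = complex_of_real (1 / sqrt 2) *s string_ket_Y y
     + (complex_of_real (1 / sqrt 2) * exp (- \<i> * complex_of_real (pi / 4))) *s string_ket_Y (flip_bits y)"

end

theory Submission
  imports Defs
begin

text \<open>
  The \<open>\<theta>\<close> basis vectors have real coordinates and complex conjugation exchanges \<open>|0\<^sup>Y\<rangle>\<close> and \<open>|1\<^sup>Y\<rangle>\<close>.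
  So if \<open>A\<close> is the amplitude of \<open>|y\<^sup>Y\<rangle>\<close> at an outcome \<open>x\<close>, then that of the flipped string is the
  conjugate of \<open>A\<close>, and a superposition with relative phase \<open>w\<close> gives \<open>x\<close> the probability
  \<open>|A|\<^sup>2 + Re (A\<^sup>2 / w)\<close>. Qubit by qubit, \<open>A\<^sup>2 = 2\<^sup>-\<^sup>n (-1)\<^bsup>|x| + y \<cdot> \<theta>\<^esup> \<i>\<^bsup>|\<theta>|\<^esup>\<close>. Half of all strings have
  a given parity, so everything reduces to the sign of \<open>Re (\<i>\<^bsup>|\<theta>|\<^esup> / w) = \<plusminus> cos (\<pi> / 4)\<close>.
\<close>

text \<open>Distributivity of products over sums, indexed by functions. It serves twice: inner
  products of product vectors factor over the qubits, and so does the parity character sum over bit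
  strings.\<close>

lemma prod_sum_fun:
  fixes f :: "'n::finite \<Rightarrow> 'b::finite \<Rightarrow> 'c::comm_semiring_1"
  shows "(\<Prod>i\<in>UNIV. \<Sum>b\<in>UNIV. f i b) = (\<Sum>s\<in>UNIV. \<Prod>i\<in>UNIV. f i (s i))"
  using prod_sum_PiE[of "UNIV :: 'n set" "\<lambda>_. UNIV" f] by (simp add: PiE_UNIV_domain)

lemma braket_tensor:
  fixes v w :: "'n::finite \<Rightarrow> qubit"
  shows "braket (tensor v) (tensor w) = (\<Prod>i\<in>UNIV. braket (v i) (w i))"
  by (simp add: braket_def tensor_def prod_sum_fun prod.distrib)

lemma braket_add_scaled:
  "braket u (a *s v + b *s w) = a * braket u v + b * braket u w"
  by (simp add: braket_def sum.distrib sum_distrib_left algebra_simps)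

lemma ket_components:
  "ket_Z b $ c = of_bool (b = c)"
  "ket_X b $ c = (if b \<and> c then -1 else 1) / complex_of_real (sqrt 2)"
  "ket_Y b $ c = (if c then if b then -\<i> else \<i> else 1) / complex_of_real (sqrt 2)"
  by (auto simp: ket_X_def ket_Y_def ket_Z_def axis_def)

definition amp_Y :: "bool \<Rightarrow> bool \<Rightarrow> bool \<Rightarrow> complex" where
  "amp_Y t a b = braket (if t then ket_X a else ket_Z a) (ket_Y b)"

lemma amp_Y_flip: "amp_Y t a (\<not> b) = cnj (amp_Y t a b)"
  by (cases t; cases a; cases b) (simp_all add: amp_Y_def braket_def ket_components UNIV_bool)

text \<open>The amplitude itself may carry an eighth root of unity, such as
  \<open>(1 + \<i>) / 2\<close>; squaring leaves a fourth root and hence a formula uniform in all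
  three bits.\<close>

lemma amp_Y_square:
  "(amp_Y t a b)\<^sup>2 = (-1) ^ (of_bool a + of_bool b * of_bool t) * \<i> ^ of_bool t / 2"
proof -
  have "(complex_of_real (sqrt 2))\<^sup>2 = 2"
    by (simp flip: of_real_power)
  then show ?thesis
    by (cases t; cases a; cases b)
       (simp_all add: amp_Y_def braket_def ket_components UNIV_bool power2_eq_square field_simps)
qed

lemma minus_one_power_parity:
  "(-1 :: 'a::ring_1) ^ parity x = (-1) ^ (\<Sum>i\<in>UNIV. of_bool (x i))"
  unfolding parity_def minus_one_power_iff by simp

lemma prod_amp_Y_square:
  fixes \<theta> x y :: "'n::finite bits"
  shows "(\<Prod>i\<in>UNIV. amp_Y (\<theta> i) (x i) (y i))\<^sup>2
    = (1 / 2) ^ CARD('n) * (-1) ^ (parity x + dot_bits y \<theta>) * \<i> ^ hamming_weight \<theta>"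
proof -
  have "(\<Prod>i\<in>UNIV. amp_Y (\<theta> i) (x i) (y i))\<^sup>2 = (\<Prod>i\<in>UNIV. 1 / 2 *
      (-1) ^ (of_bool (x i) + of_bool (y i) * of_bool (\<theta> i)) * \<i> ^ of_bool (\<theta> i))"
    unfolding prod_power_distrib amp_Y_square by (simp add: mult_ac)
  also have "\<dots> = (1 / 2) ^ CARD('n) *
      (-1) ^ ((\<Sum>i\<in>UNIV. of_bool (x i)) + dot_bits y \<theta>) * \<i> ^ (\<Sum>i\<in>UNIV. of_bool (\<theta> i))"
    unfolding prod.distrib
    by (simp only: power_sum[symmetric] sum.distrib dot_bits_def prod_constant)
  also have "(\<Sum>i\<in>UNIV. of_bool (\<theta> i) :: nat) = hamming_weight \<theta>"
    by (simp add: hamming_weight_def)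
  also have "(-1 :: complex) ^ ((\<Sum>i\<in>UNIV. of_bool (x i)) + dot_bits y \<theta>)
      = (-1) ^ (parity x + dot_bits y \<theta>)"
    by (simp only: power_add minus_one_power_parity)
  finally show ?thesis .
qed

text \<open>A common form for \<open>phi\<close> and \<open>psi\<close>, which differ only in the
  phase \<open>w\<close>.\<close>

definition Y_superposition :: "complex \<Rightarrow> 'n::finite bits \<Rightarrow> 'n qubits" where
  "Y_superposition w y = complex_of_real (1 / sqrt 2) *s string_ket_Y y
     + (complex_of_real (1 / sqrt 2) * w) *s string_ket_Y (flip_bits y)"

text \<open>The cross term is \<open>a * cnj (w * cnj a)\<close>, that is
  \<open>a\<^sup>2 * cnj w\<close>, so interference depends on \<open>a\<close> only through its
  square.\<close>

lemma cmod_add_scaled_cnj_square: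
  assumes "cmod w = 1"
  shows "(cmod (a + w * cnj a))\<^sup>2 = 2 * ((cmod a)\<^sup>2 + Re (a\<^sup>2 * cnj w))"
proof -
  have "(cmod (a + w * cnj a))\<^sup>2 = (cmod a)\<^sup>2 + (cmod (w * cnj a))\<^sup>2 + 2 * Re (a\<^sup>2 * cnj w)"
    by (simp only: cmod_power2) (simp add: power2_eq_square algebra_simps)
  then show ?thesis
    using assms by (simp add: norm_mult)
qed

lemma outcome_prob_Y_superposition:
  fixes \<theta> x y :: "'n::finite bits"
  assumes "cmod w = 1"
  shows "outcome_prob \<theta> (Y_superposition w y) x
    = (1 / 2) ^ CARD('n) * (1 + (-1) ^ (parity x + dot_bits y \<theta>) * Re (\<i> ^ hamming_weight \<theta> * cnj w))"
proof -
  define A where "A = (\<Prod>i\<in>UNIV. amp_Y (\<theta> i) (x i) (y i))"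
  define s :: real where "s = (-1) ^ (parity x + dot_bits y \<theta>)"
  have "braket (basis_ket \<theta> x) (string_ket_Y y) = A"
    by (simp add: A_def basis_ket_def string_ket_Y_def braket_tensor amp_Y_def)
  moreover have "braket (basis_ket \<theta> x) (string_ket_Y (flip_bits y)) = cnj A"
    by (simp add: A_def basis_ket_def string_ket_Y_def braket_tensor flip_bits_def
        flip: amp_Y_flip) (simp add: amp_Y_def)
  ultimately have "braket (basis_ket \<theta> x) (Y_superposition w y)
      = complex_of_real (1 / sqrt 2) * (A + w * cnj A)"
    by (simp only: Y_superposition_def braket_add_scaled distrib_left mult.assoc)
  then have prob: "outcome_prob \<theta> (Y_superposition w y) x = (cmod A)\<^sup>2 + Re (A\<^sup>2 * cnj w)"
    by (simp add: outcome_prob_def norm_mult norm_divide power_mult_distrib power_divide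
        cmod_add_scaled_cnj_square[OF assms])
  have A2: "A\<^sup>2 = complex_of_real ((1 / 2) ^ CARD('n) * s) * \<i> ^ hamming_weight \<theta>"
    by (simp add: A_def s_def prod_amp_Y_square)
  have "(cmod A)\<^sup>2 = cmod (A\<^sup>2)"
    by (simp add: norm_power)
  also have "\<dots> = (1 / 2) ^ CARD('n)"
    unfolding A2 norm_mult norm_power norm_of_real by (simp add: s_def abs_mult power_abs)
  finally have "(cmod A)\<^sup>2 = (1 / 2) ^ CARD('n)" .
  moreover have "Re (A\<^sup>2 * cnj w)
      = (1 / 2) ^ CARD('n) * s * Re (\<i> ^ hamming_weight \<theta> * cnj w)"
    unfolding A2 mult.assoc[of "complex_of_real _"] scaleR_conv_of_real[symmetric] by simp
  ultimately show ?thesis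
    by (simp add: prob s_def algebra_simps)
qed

lemma card_parity_eq:
  assumes "r < 2"
  shows "real (card {x :: 'n::finite bits. parity x = r}) = 2 ^ CARD('n) / 2"
proof -
  have "(\<Sum>x\<in>UNIV. (-1 :: real) ^ parity (x :: 'n bits))
      = (\<Sum>x\<in>UNIV. \<Prod>i\<in>UNIV. (-1) ^ of_bool ((x :: 'n bits) i))"
    by (simp only: minus_one_power_parity power_sum)
  also have "\<dots> = (\<Prod>i\<in>(UNIV :: 'n set). \<Sum>b\<in>UNIV. (-1) ^ of_bool b)"
    by (rule prod_sum_fun[symmetric])
  \<comment> \<open>Each factor is 1 + (-1), and there is at least one factor since types are
    inhabited.\<close>
  also have "\<dots> = 0"
    by (simp add: UNIV_bool)
  finally have balanced: "(\<Sum>x\<in>UNIV. (-1 :: real) ^ parity (x :: 'n bits)) = 0" .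
  \<comment> \<open>The indicator of a parity class is an average of two characters, of which only
    the trivial one survives summation.\<close>
  have indicator: "of_bool (parity x = r) = (1 + (-1 :: real) ^ r * (-1) ^ parity x) / 2"
    for x :: "'n bits"
  proof -
    have "parity x < 2" by (simp add: parity_def)
    with assms show ?thesis by (auto simp: less_2_cases_iff)
  qed
  have "real (card {x :: 'n bits. parity x = r}) = (\<Sum>x\<in>(UNIV :: 'n bits set). of_bool (parity x = r))"
    by simp
  also have "\<dots> = CARD('n bits) / 2"
    unfolding indicator sum_divide_distrib[symmetric] sum.distrib sum_distrib_left[symmetric] balanced
    by simp
  finally show ?thesis
    by (simp add: card_fun)
qed

text \<open>Outcome probabilities depend on \<open>x\<close> only through its parity, so the event
  contributes one value \<open>2 ^ CARD('n) / 2\<close> times.\<close>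

lemma event_prob_Y_superposition:
  fixes \<theta> y :: "'n::finite bits"
  assumes "cmod w = 1" and "r < 2"
  shows "event_prob \<theta> (Y_superposition w y) (\<lambda>x. parity x = r)
    = (1 + (-1) ^ (r + dot_bits y \<theta>) * Re (\<i> ^ hamming_weight \<theta> * cnj w)) / 2"
  unfolding event_prob_def outcome_prob_Y_superposition[OF assms(1)]
  by (simp add: card_parity_eq[OF assms(2)] power_one_over)

lemma cos_pi_8_square: "(cos (pi / 8))\<^sup>2 = (1 + sqrt 2 / 2) / 2"
  using cos_double_cos[of "pi / 8"] by (simp add: cos_45 field_simps)

lemma i_power_mod_4: "\<i> ^ k = \<i> ^ (k mod 4)"
proof -
  have "\<i> ^ k = \<i> ^ (4 * (k div 4) + k mod 4)" by simp
  also have "\<dots> = \<i> ^ (k mod 4)" by (simp only: power_add power_mult) simp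
  finally show ?thesis .
qed

text \<open>The argument is \<open>k * pi / 2\<close> minus or plus \<open>pi / 4\<close>, an odd
  multiple of \<open>pi / 4\<close>; the cosine is positive for two consecutive residues of
  \<open>k\<close> modulo 4.\<close>

lemma Re_i_power_mult:
  "Re (\<i> ^ k * cnj (exp (\<i> * complex_of_real (pi / 4))))
    = (if k mod 4 \<in> {0, 1} then 1 else -1) * (sqrt 2 / 2)"
  "Re (\<i> ^ k * cnj (exp (- \<i> * complex_of_real (pi / 4))))
    = (if k mod 4 \<in> {0, 3} then 1 else -1) * (sqrt 2 / 2)"
proof -
  have "k mod 4 < 4" by simp
  then consider "k mod 4 = 0" | "k mod 4 = 1" | "k mod 4 = 2" | "k mod 4 = 3" by linarith
  then show
    "Re (\<i> ^ k * cnj (exp (\<i> * complex_of_real (pi / 4))))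
      = (if k mod 4 \<in> {0, 1} then 1 else -1) * (sqrt 2 / 2)"
    "Re (\<i> ^ k * cnj (exp (- \<i> * complex_of_real (pi / 4))))
      = (if k mod 4 \<in> {0, 3} then 1 else -1) * (sqrt 2 / 2)"
    unfolding i_power_mod_4[of k]
    by (cases; simp add: Re_exp Im_exp cos_45 sin_45 power3_eq_cube)+
qed

text \<open>The extra 1 in the predicted parity when \<open>c\<close> fails cancels the negative
  sign of the real part, so both cases give \<open>(1 + sqrt 2 / 2) / 2\<close>.\<close>

lemma event_prob_parity_rule:
  fixes \<theta> y :: "'n::finite bits"
  assumes "cmod w = 1"
    and "Re (\<i> ^ hamming_weight \<theta> * cnj w) = (if c then 1 else -1) * (sqrt 2 / 2)"
  shows "event_prob \<theta> (Y_superposition w y)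
      (\<lambda>x. parity x = (if c then dot_bits y \<theta> mod 2 else (dot_bits y \<theta> + 1) mod 2))
    = (cos (pi / 8))\<^sup>2"
  by (subst event_prob_Y_superposition[OF assms(1)], simp, unfold assms(2) cos_pi_8_square)
     (simp add: minus_one_power_iff)

theorem theorem3:
  fixes y :: "'n::finite bits"
  shows "(\<forall>\<theta>. event_prob \<theta> (phi y)
            (\<lambda>x. parity x =
              (if hamming_weight \<theta> mod 4 \<in> {0, 1}
               then dot_bits y \<theta> mod 2
               else (dot_bits y \<theta> + 1) mod 2))
          = (cos (pi / 8))\<^sup>2) \<and>
         (\<forall>\<theta>. event_prob \<theta> (psi y)
            (\<lambda>x. parity x =
              (if hamming_weight \<theta> mod 4 \<in> {0, 3}
               then dot_bits y \<theta> mod 2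
               else (dot_bits y \<theta> + 1) mod 2))
          = (cos (pi / 8))\<^sup>2)"
proof -
  have rep: "phi y = Y_superposition (exp (\<i> * complex_of_real (pi / 4))) y"
    "psi y = Y_superposition (exp (- \<i> * complex_of_real (pi / 4))) y"
    by (simp_all only: phi_def psi_def Y_superposition_def)
  have unit: "cmod (exp (\<i> * complex_of_real (pi / 4))) = 1"
    "cmod (exp (- \<i> * complex_of_real (pi / 4))) = 1"
    by (simp_all add: norm_exp_eq_Re)
  show ?thesis
    unfolding rep
    by (intro conjI allI event_prob_parity_rule unit Re_i_power_mult)
qed

end
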